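(* For primes $p\equiv11\pmod{12}$, let $g_{p^3}$ be the genus of $X_0(p^3)$ and let $V_0,V_\infty$ be the vertical $\mathbb{Q}$-divisors on the minimal regular model $\mathcal{X}_0(p^3)$ over $\mathbb{Z}$ given explicitly in the context. Then $$\frac{1}{g_{p^3}-1}\left(g_{p^3}\langle V_0,V_\infty\rangle-\frac{V_0^2+V_\infty^2}{2}\right)=3\,g_{p^3}\log(p)+o\big(g_{p^3}\log p\big)\quad\text{as }p\to\infty,$$ with $p$ running over primes $\equiv11\pmod{12}$.
   Context: For $p\equiv11\pmod{12}$ one has $g_{p^3}=1+\frac{p(p+4)(p-3)}{12}$. $\mathcal{X}_0(p^3)$ is the minimal regular model of $X_0(p^3)$ over $\mathbb{Z}$ (it is Edixhoven's regular model). Its fibre over $\mathbb{F}_p$ has components $C_{3,0},C_{0,3},C_{2,1},C_{1,2}$ ($C_{a,b}$ being the reduced Katz–Mazur $(a,b)$-component) and exceptional components $E$ (over $j=1728$) and $F_1,F_2$ (over $j=0$). Their intersection matrix, in the order $C_{3,0},C_{0,3},C_{2,1},C_{1,2},E,F_1,F_2$, is $$\begin{pmatrix} -\frac{p^3-p^2+14}{12} & \frac{p-11}{12} & \frac{p^2-p-14}{12} & \frac{p-11}{12} & 1&1&0\\ \frac{p-11}{12} & -\frac{p^3-p^2+14}{12} & \frac{p-11}{12} & \frac{p^2-p-14}{12} & 1&0&1\\ \frac{p^2-p-14}{12} & \frac{p-11}{12} & -\frac{p+7}{6} & \frac{p-11}{12} & 1&1&0\\ \frac{p-11}{12} & \frac{p^2-p-14}{12}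 & \frac{p-11}{12} & -\frac{p+7}{6} & 1&0&1\\ 1&1&1&1&-2&0&0\\ 1&0&1&0&0&-2&1\\ 0&1&0&1&0&1&-2 \end{pmatrix}.$$ For vertical divisors over $p$, the Arakelov pairing is $\langle V,W\rangle=(V\cdot W)\log p$ with $V\cdot W$ the usual intersection number, and $V^2=\langle V,V\rangle$. The divisors are $V_0=x_1C_{3,0}+x_2C_{0,3}+x_3C_{2,1}+x_4C_{1,2}+x_5E+x_6F_1+x_7F_2$ and $V_\infty=x_1'C_{3,0}+x_2'C_{0,3}+x_3'C_{2,1}+x_4'C_{1,2}+x_5'E+x_6'F_1+x_7'F_2$ with $x_1=\frac{\frac53p^2-\frac73p-6}{p^2-p}$, $x_2=\frac{-\frac43p^3-\frac83p^2+\frac{86}{3}p-18}{p^3-p}$, $x_3=\frac{\frac23p^2-\frac13p-6}{p}$, $x_4=\frac{-\frac13p^3+\frac13p^2+\frac{20}{3}p-18}{p^2+p}$, $x_5=\frac{\frac16p^2+\frac16p-2}{p-1}$, $x_6=\frac{\frac13p^2+\frac13p-4}{p-1}$, $x_7=0$; $x_1'=\frac{-\frac53p^3-\frac{10}{3}p^2+\frac{97}{3}p-14}{p^3-p}$, $x_2'=\frac{\frac43p^2-\frac83p-2}{p^2-p}$, $x_3'=\frac{-\frac23p^3-\frac13p^2+\frac{31}{3}p-14}{p^2+p}$, $x_4'=\frac{\frac13p^2-\frac23p-2}{p}$, $x_5'=\frac{-\frac16p^2-\frac16p+2}{p-1}$, $x_6'=\frac{-\frac13p^2-\frac13p+4}{p-1}$,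 $x_7'=0$. (They are chosen so that, for $m\in\{0,\infty\}$, $K-(2g_{p^3}-2)H_m+V_m$ is orthogonal to all vertical divisors, where $K$ is a canonical divisor of $\mathcal{X}_0(p^3)$ and $H_0,H_\infty$ are the sections given by the cusps $0,\infty$, meeting $C_{0,3}$ and $C_{3,0}$ respectively.) *)

theory Defs
  imports
    "HOL-Analysis.Analysis"
    "HOL-Library.Landau_Symbols"
    "HOL-Combinatorics.Orbits"
begin

section \<open>The genus of \<open>X\<^sub>0(N)\<close>\<close>

definition SL2Z :: "(int^2^2) set" where
  "SL2Z = {A. det A = 1}"

definition Gamma0 :: "nat \<Rightarrow> (int^2^2) set" where
  "Gamma0 N = {A \<in> SL2Z. int N dvd A $ 2 $ 1}"

definition right_translate :: "int^2^2 \<Rightarrow> (int^2^2) set \<Rightarrow> (int^2^2) set" where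
  "right_translate M X = (\<lambda>A. A ** M) ` X"

definition Gamma0_cosets :: "nat \<Rightarrow> (int^2^2) set set" where
  "Gamma0_cosets N = {right_translate B (Gamma0 N) | B. B \<in> SL2Z}"

definition mat_S :: "int^2^2" where
  "mat_S = vector [vector [0, -1], vector [1, 0]]"

definition mat_T :: "int^2^2" where
  "mat_T = vector [vector [1, 1], vector [0, 1]]"

text \<open>
  The permutation of the cosets has finite order (for \<open>N > 0\<close>), so the forward orbits
  given by \<^const>\<open>orbit\<close> are the orbits of the cyclic group generated by \<open>M\<close>.
\<close>

definition num_orbits :: "nat \<Rightarrow> int^2^2 \<Rightarrow> nat" where
  "num_orbits N M = card ((\<lambda>X. orbit (right_translate M) X) ` Gamma0_cosets N)"

text \<open>
  The compact Riemann surface \<open>X\<^sub>0(N)\<close> is cut into cells by the translates of the geodesic arc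
  from \<open>i\<close> to \<open>\<rho> = exp (2 \<pi> i / 3)\<close>. Here \<open>\<Gamma>\<^sub>0(N)\<close> contains \<open>-1\<close>, so the edges correspond to the
  cosets \<open>\<Gamma>\<^sub>0(N) g\<close> in \<open>SL\<^sub>2(\<int>)\<close>. The stabilisers of \<open>i\<close>, \<open>\<rho>\<close> and \<open>\<infinity>\<close> in \<open>SL\<^sub>2(\<int>)\<close> are generated,
  up to sign, by \<open>S\<close>, \<open>S T\<close> and \<open>T\<close>; hence the vertices over \<open>j = 1728\<close> and \<open>j = 0\<close> are
  the orbits of \<open>S\<close> and \<open>S T\<close> on the cosets, and the faces (one for each cusp) are the orbits
  of \<open>T\<close>. The genus \<open>g\<close> is given by \<open>2 - 2 g = vertices - edges + faces\<close>.
\<close>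

definition euler_char_X0 :: "nat \<Rightarrow> int" where
  "euler_char_X0 N =
     int (num_orbits N mat_S + num_orbits N (mat_S ** mat_T))
     - int (card (Gamma0_cosets N)) + int (num_orbits N mat_T)"

definition genus_X0 :: "nat \<Rightarrow> real" where
  "genus_X0 N = (2 - real_of_int (euler_char_X0 N)) / 2"


section \<open>Vertical divisors over \<open>p\<close> on the minimal regular model of \<open>X\<^sub>0(p\<^sup>3)\<close>\<close>

text \<open>
  The components of the fibre over \<open>\<bbbF>\<^sub>p\<close> of Edixhoven's regular model, for \<open>p \<equiv> 11\<close> modulo \<open>12\<close>:
  \<open>Cab\<close> is the reduced Katz--Mazur \<open>(a,b)\<close>-component, \<open>E\<close> is the exceptional component
  over \<open>j = 1728\<close>, and \<open>F1\<close>, \<open>F2\<close> are those over \<open>j = 0\<close>.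
\<close>

datatype component = C30 | C03 | C21 | C12 | E | F1 | F2

lemma UNIV_component: "UNIV = {C30, C03, C21, C12, E, F1, F2}"
  by (auto intro: component.exhaust)

instance component :: finite
  by standard (simp add: UNIV_component)

text \<open>Each row lists the entries in the order \<open>C30, C03, C21, C12, E, F1, F2\<close>.\<close>

definition component_intersection :: "nat \<Rightarrow> component \<Rightarrow> component \<Rightarrow> rat" where
  "component_intersection p' C D =
    (let p = of_nat p';
         a = - (p^3 - p^2 + 14) / 12;
         b = (p - 11) / 12;
         c = (p^2 - p - 14) / 12;
         d = - (p + 7) / 6
     in case C of
       C30 \<Rightarrow> case_component a b c b 1 1 0 D
     | C03 \<Rightarrow> case_component b a b c 1 0 1 D
     | C21 \<Rightarrow> case_component c b d b 1 1 0 D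
     | C12 \<Rightarrow> case_component b c b d 1 0 1 D
     | E   \<Rightarrow> case_component 1 1 1 1 (-2) 0 0 D
     | F1  \<Rightarrow> case_component 1 0 1 0 0 (-2) 1 D
     | F2  \<Rightarrow> case_component 0 1 0 1 0 1 (-2) D)"

text \<open>A vertical \<open>\<rat>\<close>-divisor is given by its multiplicities along the components.\<close>

type_synonym vdivisor = "component \<Rightarrow> rat"

definition intersection_number :: "nat \<Rightarrow> vdivisor \<Rightarrow> vdivisor \<Rightarrow> rat" where
  "intersection_number p V W =
     (\<Sum>C\<in>UNIV. \<Sum>D\<in>UNIV. V C * W D * component_intersection p C D)"

definition arakelov_pairing :: "nat \<Rightarrow> vdivisor \<Rightarrow> vdivisor \<Rightarrow> real" where
  "arakelov_pairing p V W = real_of_rat (intersection_number p V W) * ln (real p)"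

definition V_zero :: "nat \<Rightarrow> vdivisor" where
  "V_zero p' =
    (let p = of_nat p' in case_component
       ((5/3 * p^2 - 7/3 * p - 6) / (p^2 - p))
       ((- 4/3 * p^3 - 8/3 * p^2 + 86/3 * p - 18) / (p^3 - p))
       ((2/3 * p^2 - 1/3 * p - 6) / p)
       ((- 1/3 * p^3 + 1/3 * p^2 + 20/3 * p - 18) / (p^2 + p))
       ((1/6 * p^2 + 1/6 * p - 2) / (p - 1))
       ((1/3 * p^2 + 1/3 * p - 4) / (p - 1))
       0)"

definition V_infinity :: "nat \<Rightarrow> vdivisor" where
  "V_infinity p' =
    (let p = of_nat p' in case_component
       ((- 5/3 * p^3 - 10/3 * p^2 + 97/3 * p - 14) / (p^3 - p))
       ((4/3 * p^2 - 8/3 * p - 2) / (p^2 - p))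
       ((- 2/3 * p^3 - 1/3 * p^2 + 31/3 * p - 14) / (p^2 + p))
       ((1/3 * p^2 - 2/3 * p - 2) / p)
       ((- 1/6 * p^2 - 1/6 * p + 2) / (p - 1))
       ((- 1/3 * p^2 - 1/3 * p + 4) / (p - 1))
       0)"

definition primes_11_mod_12 :: "nat filter" where
  "primes_11_mod_12 = inf at_top (principal {p. prime p \<and> p mod 12 = 11})"

end

theory Submission
  imports Defs "HOL-Number_Theory.Residues" "HOL-Real_Asymp.Real_Asymp"
begin

text \<open>
  Divide the expression by \<open>g log p\<close>, where \<open>g\<close> is the genus of \<open>X\<^sub>0(p\<^sup>3)\<close>. What is left is a statement
  on rational numbers: \<open>(V\<^sub>0 \<cdot> V\<^sub>\<infinity> - (V\<^sub>0\<^sup>2 + V\<^sub>\<infinity>\<^sup>2) / (2 g)) / (g - 1)\<close> tends to \<open>3\<close>. Since \<open>g\<close> and the three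
  intersection numbers all have order \<open>p\<^sup>3\<close>, the self-intersections contribute only \<open>O(p\<^sup>-\<^sup>3)\<close>, and it
  is enough to know two leading coefficients: \<open>g\<close> grows like \<open>p\<^sup>3/12\<close> and \<open>V\<^sub>0 \<cdot> V\<^sub>\<infinity>\<close> like \<open>p\<^sup>3/4\<close>.

  \<^bold>\<open>The genus.\<close> The cosets of \<open>\<Gamma>\<^sub>0(N)\<close> in \<open>SL\<^sub>2(\<int>)\<close> are the points of the projective line over \<open>\<int>/N\<close>,
  by the bottom row; for \<open>N = p\<^sup>3\<close> there are \<open>p\<^sup>3 + p\<^sup>2\<close> of them (\<open>card_Gamma0_cosets_prime_power\<close>).
  A fixed point of \<open>S\<close> or of \<open>S T\<close> would be a primitive zero modulo \<open>p\<close> of \<open>c\<^sup>2 + d\<^sup>2\<close> or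
  \<open>c\<^sup>2 - c d + d\<^sup>2\<close>, and these forms are anisotropic modulo \<open>p\<close> because \<open>p\<close> is \<open>3\<close> modulo \<open>4\<close> and \<open>2\<close>
  modulo \<open>3\<close>. So the cosets split into orbits of size exactly \<open>2\<close> and \<open>3\<close> respectively. There are at
  most \<open>p\<^sup>2 + 1\<close> orbits of \<open>T\<close>, since \<open>T\<close> permutes the affine line \<open>(1 : j)\<close> cyclically
  (\<open>num_orbits_mat_T_le\<close>). With \<open>\<mu> = p\<^sup>3 + p\<^sup>2\<close> this gives \<open>g = \<mu>/12 + O(p\<^sup>2)\<close>.

  \<^bold>\<open>The intersection numbers.\<close> Give \<open>C30\<close> and \<open>C03\<close> the weight \<open>0\<close> and the other components the
  weight \<open>1\<close>. Then the multiplicity of \<open>C\<close> has order at most \<open>p\<close> to the weight of \<open>C\<close>, and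
  the intersection number of \<open>C\<close> and \<open>D\<close> has order at most \<open>p\<close> to \<open>3\<close> minus both weights. Hence each of
  the three pairings, divided by \<open>p\<^sup>3\<close>, converges to the value of a fixed bilinear form at the vectors
  of leading coefficients (\<open>intersection_number_asymp\<close>). These vectors are \<open>v\<close> for \<open>V\<^sub>0\<close> and
  \<open>- v\<close> for \<open>V\<^sub>\<infinity>\<close>, so that a single number, the value \<open>- 1/4\<close> of the form at \<open>v\<close>, gives all three limits
  (\<open>leading_self_intersection\<close>).
\<close>

section \<open>Orbits of a map of finite order\<close>

lemma cyclic_on_orbit_of_finite_order:
  assumes "(f ^^ n) x = x" "n > 0"
  shows "cyclic_on f (orbit f x)"
proof -
  have "x \<in> orbit f x"
    using assms unfolding orbit_altdef by (metis (mono_tags, lifting) mem_Collect_eq)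
  then show ?thesis
    by (intro cyclic_on_singleI[of x]) auto
qed

text \<open>
  The least period of a point divides the prime \<open>r\<close> and is not \<open>1\<close>, so it is \<open>r\<close>: all orbits have
  \<open>r\<close> elements, and they partition \<open>X\<close>.
\<close>

lemma card_orbits_of_prime_order:
  fixes f :: "'a \<Rightarrow> 'a"
  assumes fin: "finite X" and closed: "f ` X \<subseteq> X" and r: "prime r"
    and order: "\<And>x. x \<in> X \<Longrightarrow> (f ^^ r) x = x"
    and no_fix: "\<And>x. x \<in> X \<Longrightarrow> f x \<noteq> x"
  shows "r * card (orbit f ` X) = card X"
proof -
  have self: "x \<in> orbit f x" if "x \<in> X" for x
    using order[OF that] prime_gt_0_nat[OF r] unfolding orbit_altdef
    by (metis (mono_tags, lifting) mem_Collect_eq)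
  have sub: "orbit f x \<subseteq> X" if "x \<in> X" for x
  proof
    fix y assume "y \<in> orbit f x"
    then show "y \<in> X" by induct (use that closed in auto)
  qed
  have Un: "\<Union> (orbit f ` X) = X"
    using self sub by auto
  have card_orbit: "card (orbit f x) = r" if x: "x \<in> X" for x
  proof -
    define d where "d = funpow_dist1 f x x"
    have d0: "d > 0" by (simp add: d_def)
    have dx: "(f ^^ d) x = x"
      unfolding d_def using funpow_dist1_prop[OF self[OF x]] .
    have "(f ^^ (r mod d)) x = x"
      using funpow_mod_eq[OF dx, of r] order[OF x] by simp
    then have "r mod d = 0"
      using funpow_dist1_least[of "r mod d" f x x] d0 unfolding d_def
      by (metis gr0I mod_less_divisor)
    then have "d dvd r" by auto
    moreover have "d \<noteq> 1"
      using dx no_fix[OF x] by auto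
    ultimately have "d = r"
      using r by (metis One_nat_def prime_nat_iff)
    moreover have "card (orbit f x) = d"
      unfolding orbit_conv_funpow_dist1[OF self[OF x]]
      using inj_on_funpow_dist1[OF self[OF x]] by (subst card_image) (auto simp: d_def)
    ultimately show ?thesis by simp
  qed
  have disj: "c1 \<inter> c2 = {}"
    if "c1 \<in> orbit f ` X" "c2 \<in> orbit f ` X" "c1 \<noteq> c2" for c1 c2
  proof (rule ccontr)
    assume "c1 \<inter> c2 \<noteq> {}"
    then obtain y where "y \<in> c1" "y \<in> c2" by auto
    moreover have "cyclic_on f c1" "cyclic_on f c2"
      using that(1,2) cyclic_on_orbit_of_finite_order[OF order prime_gt_0_nat[OF r]] by auto
    ultimately show False
      using orbit_cyclic_eq3 that(3) by metis
  qed
  have "r * card (orbit f ` X) = card (\<Union> (orbit f ` X))"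
    by (rule card_partition) (use fin Un card_orbit disj in auto)
  then show ?thesis using Un by simp
qed


section \<open>The cosets of \<open>\<Gamma>\<^sub>0(N)\<close> as points of a projective line\<close>

lemma matrix_mult_entry: "(A ** B) $ i $ j = A $ i $ 1 * B $ 1 $ j + A $ i $ 2 * B $ 2 $ j"
  for A B :: "int^2^2"
  by (simp add: matrix_matrix_mult_def sum_2)

lemma matrix2_eq_iff:
  "A = B \<longleftrightarrow> A$1$1 = B$1$1 \<and> A$1$2 = B$1$2 \<and> A$2$1 = B$2$1 \<and> A$2$2 = B$2$2"
  for A B :: "int^2^2"
  by (auto simp: vec_eq_iff forall_2)

lemma SL2Z_iff: "A \<in> SL2Z \<longleftrightarrow> A$1$1 * A$2$2 - A$1$2 * A$2$1 = 1"
  by (simp add: SL2Z_def det_2)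

lemma SL2Z_mult: "A \<in> SL2Z \<Longrightarrow> B \<in> SL2Z \<Longrightarrow> A ** B \<in> SL2Z"
  by (simp add: SL2Z_def det_mul)

definition adjugate2 :: "int^2^2 \<Rightarrow> int^2^2" where
  "adjugate2 A = vector [vector [A$2$2, - A$1$2], vector [- A$2$1, A$1$1]]"

lemma adjugate2_SL2Z: "A \<in> SL2Z \<Longrightarrow> adjugate2 A \<in> SL2Z"
  by (simp add: SL2Z_iff adjugate2_def algebra_simps)

lemma adjugate2_mult:
  assumes "A \<in> SL2Z"
  shows "A ** adjugate2 A = mat 1" "adjugate2 A ** A = mat 1"
  using assms
  by (auto simp: SL2Z_iff matrix2_eq_iff matrix_mult_entry adjugate2_def mat_def algebra_simps)

abbreviation coset :: "nat \<Rightarrow> int^2^2 \<Rightarrow> (int^2^2) set" where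
  "coset N B \<equiv> right_translate B (Gamma0 N)"

lemma right_translate_coset: "right_translate M (coset N B) = coset N (B ** M)"
  by (simp add: right_translate_def image_image matrix_mul_assoc)

lemma funpow_right_translate:
  "(right_translate M ^^ n) (coset N B) = coset N (((\<lambda>A. A ** M) ^^ n) B)"
  by (induction n) (simp_all add: right_translate_coset)

lemma Gamma0_mult: "A \<in> Gamma0 N \<Longrightarrow> B \<in> Gamma0 N \<Longrightarrow> A ** B \<in> Gamma0 N"
  by (simp add: Gamma0_def SL2Z_mult matrix_mult_entry)

text \<open>
  The number that has to be divisible by \<open>N\<close> is the lower left entry of \<open>A B\<^sup>-\<^sup>1\<close>. So a coset is
  determined by the bottom row \<open>(c : d)\<close> of its elements, up to proportionality modulo \<open>N\<close>.
\<close>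

lemma coset_eq_iff:
  assumes A: "A \<in> SL2Z" and B: "B \<in> SL2Z"
  shows "coset N A = coset N B \<longleftrightarrow> int N dvd A$2$1 * B$2$2 - A$2$2 * B$2$1"
proof
  assume eq: "coset N A = coset N B"
  have "mat 1 \<in> Gamma0 N"
    by (simp add: Gamma0_def SL2Z_iff mat_def)
  then have "A \<in> coset N A"
    unfolding right_translate_def by force
  then obtain G where G: "G \<in> Gamma0 N" "A = G ** B"
    unfolding eq by (auto simp: right_translate_def)
  have "A ** adjugate2 B = G"
    using G(2) adjugate2_mult[OF B] by (simp flip: matrix_mul_assoc)
  then have "int N dvd (A ** adjugate2 B) $ 2 $ 1"
    using G(1) by (simp add: Gamma0_def)
  then show "int N dvd A$2$1 * B$2$2 - A$2$2 * B$2$1"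
    by (simp add: matrix_mult_entry adjugate2_def)
next
  have sub: "coset N A \<subseteq> coset N B"
    if "int N dvd A$2$1 * B$2$2 - A$2$2 * B$2$1" "A \<in> SL2Z" "B \<in> SL2Z" for A B
  proof
    fix X assume "X \<in> coset N A"
    then obtain G where G: "G \<in> Gamma0 N" "X = G ** A"
      by (auto simp: right_translate_def)
    have "A ** adjugate2 B \<in> Gamma0 N"
      using that by (simp add: Gamma0_def SL2Z_mult adjugate2_SL2Z)
        (simp add: matrix_mult_entry adjugate2_def)
    then have "G ** (A ** adjugate2 B) \<in> Gamma0 N"
      by (rule Gamma0_mult[OF G(1)])
    moreover have "X = G ** (A ** adjugate2 B) ** B"
      using G(2) adjugate2_mult[OF \<open>B \<in> SL2Z\<close>] by (simp flip: matrix_mul_assoc)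
    ultimately show "X \<in> coset N B"
      unfolding right_translate_def by blast
  qed
  assume d: "int N dvd A$2$1 * B$2$2 - A$2$2 * B$2$1"
  moreover have "int N dvd B$2$1 * A$2$2 - B$2$2 * A$2$1"
    using d by (subst dvd_minus_iff[symmetric]) (simp add: algebra_simps)
  ultimately show "coset N A = coset N B"
    using sub[OF _ A B] sub[OF _ B A] by blast
qed

text \<open>
  The two families below have the bottom rows \<open>(1 : j)\<close> and \<open>(c : 1)\<close>. Modulo a prime power,
  every point of the projective line has one of these two forms.
\<close>

definition unit_first :: "nat \<Rightarrow> int^2^2" where
  "unit_first j = vector [vector [0, -1], vector [1, int j]]"

definition unit_second :: "nat \<Rightarrow> int^2^2" where
  "unit_second c = vector [vector [1, 0], vector [int c, 1]]"

lemma unit_first_SL2Z: "unit_first j \<in> SL2Z"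
  by (simp add: SL2Z_iff unit_first_def)

lemma unit_second_SL2Z: "unit_second c \<in> SL2Z"
  by (simp add: SL2Z_iff unit_second_def)

lemma coset_unit_first_eq_iff:
  "coset N (unit_first i) = coset N (unit_first j) \<longleftrightarrow> int N dvd int j - int i"
  unfolding coset_eq_iff[OF unit_first_SL2Z unit_first_SL2Z] by (simp add: unit_first_def)

lemma coset_unit_second_eq_iff:
  "coset N (unit_second i) = coset N (unit_second j) \<longleftrightarrow> int N dvd int i - int j"
  unfolding coset_eq_iff[OF unit_second_SL2Z unit_second_SL2Z] by (simp add: unit_second_def)

lemma coset_unit_first_eq_unit_second_iff:
  "coset N (unit_first i) = coset N (unit_second j) \<longleftrightarrow> int N dvd 1 - int i * int j"
  unfolding coset_eq_iff[OF unit_first_SL2Z unit_second_SL2Z]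
  by (simp add: unit_first_def unit_second_def)

text \<open>
  A point \<open>(c : d)\<close> is scaled to \<open>(1 : j)\<close> if \<open>c\<close> is prime to \<open>p\<close>. Otherwise \<open>d\<close> is prime to \<open>p\<close>, and it
  is scaled to \<open>(p k : 1)\<close>. The restriction to multiples of \<open>p\<close> makes the two families disjoint.
\<close>

lemma Gamma0_cosets_prime_power:
  assumes p: "prime p"
  shows "Gamma0_cosets (p ^ Suc n) =
    (\<lambda>j. coset (p ^ Suc n) (unit_first j)) ` {..<p ^ Suc n} \<union>
    (\<lambda>k. coset (p ^ Suc n) (unit_second (p * k))) ` {..<p ^ n}"
    (is "?L = ?A \<union> ?B")
proof
  let ?N = "p ^ Suc n"
  show "?A \<union> ?B \<subseteq> ?L"
    unfolding Gamma0_cosets_def using unit_first_SL2Z unit_second_SL2Z by blast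
  have p0: "p > 0" using p prime_gt_0_nat by blast
  have cop: "coprime a (int p ^ k)" if "\<not> int p dvd a" for a :: int and k
    using prime_imp_coprime[of "int p" a] p that coprime_commute
    by (metis coprime_power_right_iff prime_nat_int_transfer)
  show "?L \<subseteq> ?A \<union> ?B"
  proof
    fix X assume "X \<in> ?L"
    then obtain M where M: "M \<in> SL2Z" and X: "X = coset ?N M"
      by (auto simp: Gamma0_cosets_def)
    define c d where "c = M$2$1" and "d = M$2$2"
    show "X \<in> ?A \<union> ?B"
    proof (cases "int p dvd c")
      case False
      obtain u where u: "[c * u = 1] (mod int ?N)"
        using cop[OF False, of "Suc n"] cong_solve_coprime_int by (metis of_nat_power)
      define j where "j = nat ((u * d) mod int ?N)"
      have j: "j < ?N" "int j = (u * d) mod int ?N"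
        using p0 by (auto simp: j_def nat_less_iff simp del: power_Suc)
      have "[c * int j = c * (u * d)] (mod int ?N)"
        unfolding j(2) by (intro cong_mult cong_refl) (simp add: cong_def)
      also have "[c * (u * d) = 1 * d] (mod int ?N)"
        using cong_mult[OF u cong_refl[of d]] by (simp add: mult.assoc)
      finally have "int ?N dvd c * int j - d * 1"
        by (simp add: cong_iff_dvd_diff)
      then have "X = coset ?N (unit_first j)"
        unfolding X coset_eq_iff[OF M unit_first_SL2Z] by (simp add: c_def d_def unit_first_def)
      then show ?thesis using j by blast
    next
      case True
      have "\<not> int p dvd d"
      proof
        assume "int p dvd d"
        then have "int p dvd M$1$1 * d - M$1$2 * c" using True by simp
        then have "int p dvd 1" using M by (simp add: SL2Z_iff c_def d_def)
        then show False using p by auto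
      qed
      then obtain u where u: "[d * u = 1] (mod int ?N)"
        using cop[of d "Suc n"] cong_solve_coprime_int by (metis of_nat_power)
      obtain c' where c': "c = int p * c'" using True by auto
      define k where "k = nat ((u * c') mod int (p ^ n))"
      have k: "k < p ^ n" "int k = (u * c') mod int (p ^ n)"
        using p0 by (auto simp: k_def nat_less_iff)
      have "[int (p * k) = int p * (u * c')] (mod int p * int (p ^ n))"
        by (simp add: cong_def k(2))
      then have "[d * int (p * k) = d * (int p * (u * c'))] (mod int ?N)"
        by (intro cong_mult cong_refl) simp
      also have "d * (int p * (u * c')) = d * u * c" by (simp add: c')
      also have "[d * u * c = 1 * c] (mod int ?N)"
        using cong_mult[OF u cong_refl[of c]] .
      finally have "int ?N dvd c * 1 - d * int (p * k)"
        by (metis cong_iff_dvd_diff cong_sym mult_1 mult_1_right)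
      then have "X = coset ?N (unit_second (p * k))"
        unfolding X coset_eq_iff[OF M unit_second_SL2Z] by (simp add: c_def d_def unit_second_def)
      then show ?thesis using k by blast
    qed
  qed
qed

lemma card_Gamma0_cosets_prime_power:
  assumes p: "prime p"
  shows "card (Gamma0_cosets (p ^ Suc n)) = p ^ Suc n + p ^ n"
proof -
  let ?N = "p ^ Suc n"
  have p0: "p > 0" using p prime_gt_0_nat by blast
  have small: "x = y" if "int m dvd int x - int y" "x < m" "y < m" for x y m
    using that by (metis cong_iff_dvd_diff cong_int_iff cong_less_modulus_unique_nat)
  have inj1: "inj_on (\<lambda>j. coset ?N (unit_first j)) {..<?N}"
  proof (rule inj_onI)
    fix i j assume "i \<in> {..<?N}" "j \<in> {..<?N}"
      and "coset ?N (unit_first i) = coset ?N (unit_first j)"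
    then show "i = j"
      using small[of ?N j i]
      by (simp add: coset_unit_first_eq_iff del: power_Suc of_nat_power)
  qed
  have inj2: "inj_on (\<lambda>k. coset ?N (unit_second (p * k))) {..<p ^ n}"
  proof (rule inj_onI)
    fix i j assume ij: "i \<in> {..<p ^ n}" "j \<in> {..<p ^ n}"
      and "coset ?N (unit_second (p * i)) = coset ?N (unit_second (p * j))"
    then have "int p * int (p ^ n) dvd int p * (int i - int j)"
      by (simp add: coset_unit_second_eq_iff right_diff_distrib)
    then have "int (p ^ n) dvd int i - int j"
      using p0 by (metis dvd_mult_cancel_left of_nat_0_less_iff less_irrefl)
    then show "i = j" using small[of "p ^ n" i j] ij by simp
  qed
  have "coset ?N (unit_first j) \<noteq> coset ?N (unit_second (p * k))" for j k
  proof
    assume "coset ?N (unit_first j) = coset ?N (unit_second (p * k))"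
    then have "int p * int (p ^ n) dvd 1 - int j * (int p * int k)"
      by (simp add: coset_unit_first_eq_unit_second_iff)
    then have "int p dvd 1 - int j * (int p * int k)"
      by (rule dvd_mult_left)
    then have "int p dvd (1 - int j * (int p * int k)) + int j * (int p * int k)"
      by (rule dvd_add) simp
    then have "int p dvd 1" by simp
    then show False using p by auto
  qed
  then have "(\<lambda>j. coset ?N (unit_first j)) ` {..<?N} \<inter>
        (\<lambda>k. coset ?N (unit_second (p * k))) ` {..<p ^ n} = {}"
    by blast
  then show ?thesis
    unfolding Gamma0_cosets_prime_power[OF p]
    by (subst card_Un_disjoint) (simp_all add: card_image[OF inj1] card_image[OF inj2] del: power_Suc)
qed

lemma finite_Gamma0_cosets_prime_power: "prime p \<Longrightarrow> finite (Gamma0_cosets (p ^ Suc n))"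
  by (simp add: Gamma0_cosets_prime_power del: power_Suc)

lemma mat_S_SL2Z: "mat_S \<in> SL2Z" and mat_T_SL2Z: "mat_T \<in> SL2Z"
  by (simp_all add: SL2Z_iff mat_S_def mat_T_def)

lemma right_translate_Gamma0_cosets:
  "M \<in> SL2Z \<Longrightarrow> right_translate M ` Gamma0_cosets N \<subseteq> Gamma0_cosets N"
  unfolding Gamma0_cosets_def using SL2Z_mult by (auto simp: right_translate_coset)

section \<open>The absence of elliptic points\<close>

lemma fermat_theorem_int:
  fixes a :: int
  assumes p: "prime p" and a: "\<not> int p dvd a"
  shows "[a ^ (p - 1) = 1] (mod int p)"
proof -
  have p0: "p > 0" using p prime_gt_0_nat by blast
  define b where "b = nat (a mod int p)"
  have b: "[int b = a] (mod int p)"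
    using p0 by (simp add: b_def cong_def)
  then have "\<not> p dvd b"
    using a by (metis cong_dvd_iff int_dvd_int_iff dvd_refl cong_0_iff cong_trans cong_sym)
  then have "[b ^ (p - 1) = 1] (mod p)"
    using fermat_theorem p by blast
  then have "[int b ^ (p - 1) = 1] (mod int p)"
    by (metis cong_int_iff of_nat_1 of_nat_power)
  then show ?thesis
    using cong_pow[OF b, of "p - 1"] cong_trans cong_sym by blast
qed

text \<open>
  If \<open>p\<close> divides neither of the two, raise \<open>d\<^sup>2 \<equiv> - c\<^sup>2\<close> to the odd power \<open>(p - 1) / 2\<close>: by Fermat's
  theorem, \<open>1 \<equiv> - 1\<close> modulo \<open>p\<close>.
\<close>

lemma prime_dvd_sum_two_squares:
  fixes c d :: int
  assumes p: "prime p" and mod4: "p mod 4 = 3" and dvd: "int p dvd c\<^sup>2 + d\<^sup>2"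
  shows "int p dvd c \<and> int p dvd d"
proof (rule ccontr)
  assume not: "\<not> (int p dvd c \<and> int p dvd d)"
  have ip: "prime (int p)" using p by simp
  have "int p dvd c\<^sup>2 \<longleftrightarrow> int p dvd d\<^sup>2"
    using dvd by (metis dvd_add_right_iff dvd_add_left_iff)
  then have c: "\<not> int p dvd c" and d: "\<not> int p dvd d"
    using not ip by (auto simp: prime_dvd_power_iff)
  define m where "m = (p - 1) div 2"
  have m: "p - 1 = 2 * m" "odd m"
    using mod4 unfolding m_def by presburger+
  have "[d\<^sup>2 = - (c\<^sup>2)] (mod int p)"
    using dvd by (simp add: cong_iff_dvd_diff add.commute)
  then have "[(d\<^sup>2) ^ m = (- (c\<^sup>2)) ^ m] (mod int p)"
    by (rule cong_pow)
  then have "[d ^ (p - 1) = - (c ^ (p - 1))] (mod int p)"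
    using m by (simp add: power_mult)
  moreover have "[- (c ^ (p - 1)) = - 1] (mod int p)"
    using fermat_theorem_int[OF p c] cong_minus_minus_iff by blast
  ultimately have "[1 = -1] (mod int p)"
    using fermat_theorem_int[OF p d] cong_trans cong_sym by blast
  then have "int p dvd int 2" by (simp add: cong_iff_dvd_diff)
  then have "p \<le> 2" by (meson int_dvd_int_iff dvd_imp_le zero_less_numeral)
  with mod4 p show False by (cases "p = 2") (auto dest: prime_ge_2_nat)
qed

text \<open>
  The form divides \<open>c\<^sup>3 + d\<^sup>3\<close>, so \<open>d\<close> and \<open>- c\<close> have the same cube modulo \<open>p\<close>. Cubing is
  injective because \<open>3\<close> does not divide \<open>p - 1\<close>: as \<open>3\<close> divides \<open>p - 2\<close>, the inverse
  \<open>x\<^bsup>p - 2\<^esup>\<close> of \<open>x\<close> is a power of \<open>x\<^sup>3\<close>. Hence \<open>d \<equiv> - c\<close>, and the form becomes \<open>3 c\<^sup>2\<close>.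
\<close>

lemma prime_dvd_eisenstein_norm:
  fixes c d :: int
  assumes p: "prime p" and mod3: "p mod 3 = 2" and dvd: "int p dvd c\<^sup>2 - c * d + d\<^sup>2"
  shows "int p dvd c \<and> int p dvd d"
proof (rule ccontr)
  assume not: "\<not> (int p dvd c \<and> int p dvd d)"
  have ip: "prime (int p)" using p by simp
  have p2: "p \<ge> 2" using p prime_ge_2_nat by blast
  have "int p dvd c \<longleftrightarrow> int p dvd d"
  proof
    assume "int p dvd c"
    then have "int p dvd (c\<^sup>2 - c * d + d\<^sup>2) - c * (c - d)" using dvd by simp
    then have "int p dvd d\<^sup>2" by (simp add: algebra_simps power2_eq_square)
    then show "int p dvd d" using ip prime_dvd_power by blast
  next
    assume "int p dvd d"
    then have "int p dvd (c\<^sup>2 - c * d + d\<^sup>2) - d * (d - c)" using dvd by simp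
    then have "int p dvd c\<^sup>2" by (simp add: algebra_simps power2_eq_square)
    then show "int p dvd c" using ip prime_dvd_power by blast
  qed
  then have c: "\<not> int p dvd c" and d: "\<not> int p dvd d"
    using not by auto
  then have c': "\<not> int p dvd - c" by simp
  define m where "m = (p - 2) div 3"
  have m: "p - 2 = 3 * m"
    using mod3 p2 unfolding m_def by presburger
  have "int p dvd (c + d) * (c\<^sup>2 - c * d + d\<^sup>2)"
    using dvd by simp
  then have "[d ^ 3 = (- c) ^ 3] (mod int p)"
    by (simp add: cong_iff_dvd_diff algebra_simps power2_eq_square power3_eq_cube)
  then have "[(d ^ 3) ^ m = ((- c) ^ 3) ^ m] (mod int p)"
    by (rule cong_pow)
  then have eq: "[d ^ (p - 2) = (- c) ^ (p - 2)] (mod int p)"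
    by (simp only: m power_mult)
  have Suc: "x * x ^ (p - 2) = x ^ (p - 1)" for x :: int
    using p2 by (metis Suc_1 Suc_diff_le diff_Suc_Suc power_Suc)
  have "[- c * d * d ^ (p - 2) = - c * d * (- c) ^ (p - 2)] (mod int p)"
    using eq by (intro cong_mult cong_refl)
  then have "[- c * d ^ (p - 1) = d * (- c) ^ (p - 1)] (mod int p)"
    using Suc[of d] Suc[of "- c"] by (metis mult.assoc mult.left_commute)
  moreover have "[- c * d ^ (p - 1) = - c * 1] (mod int p)"
    by (intro cong_mult cong_refl fermat_theorem_int p d)
  moreover have "[d * (- c) ^ (p - 1) = d * 1] (mod int p)"
    by (intro cong_mult cong_refl fermat_theorem_int p c')
  ultimately have "[- c = d] (mod int p)"
    by (metis cong_sym cong_trans mult_1_right)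
  then have "int p dvd c + d"
    by (metis cong_iff_dvd_diff cong_sym diff_minus_eq_add add.commute)
  then have "int p dvd (c\<^sup>2 - c * d + d\<^sup>2) - (c + d) * (d - 2 * c)"
    using dvd by simp
  then have "int p dvd 3 * c\<^sup>2"
    by (simp add: algebra_simps power2_eq_square)
  then have "int p dvd int 3"
    using c ip by (auto simp: prime_dvd_mult_iff prime_dvd_power_iff)
  then have "p dvd 3" by (simp only: int_dvd_int_iff)
  then have "p = 1 \<or> p = 3"
    using prime_nat_iff[of 3] by (simp add: primes_dvd_imp_eq p)
  with mod3 p show False by auto
qed

lemma SL2Z_bottom_row_not_both_dvd:
  assumes "B \<in> SL2Z" "prime p"
  shows "\<not> (int p dvd B$2$1 \<and> int p dvd B$2$2)"
proof
  assume "int p dvd B$2$1 \<and> int p dvd B$2$2"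
  then have "int p dvd B$1$1 * B$2$2 - B$1$2 * B$2$1" by simp
  then show False using assms by (auto simp: SL2Z_iff)
qed

text \<open>
  The coset of \<open>(c : d)\<close> goes to that of \<open>(d : - c)\<close>. It is fixed if and only if \<open>p\<^bsup>n + 1\<^esup>\<close>
  divides \<open>c\<^sup>2 + d\<^sup>2\<close>.
\<close>

lemma num_orbits_mat_S:
  assumes p: "prime p" and mod4: "p mod 4 = 3"
  shows "2 * num_orbits (p ^ Suc n) mat_S = card (Gamma0_cosets (p ^ Suc n))"
  unfolding num_orbits_def
proof (rule card_orbits_of_prime_order)
  fix X assume "X \<in> Gamma0_cosets (p ^ Suc n)"
  then obtain B where B: "B \<in> SL2Z" and X: "X = coset (p ^ Suc n) B"
    by (auto simp: Gamma0_cosets_def)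
  \<comment> \<open>\<open>S\<^sup>2 = - 1\<close> does not change a bottom row up to proportionality.\<close>
  have "coset (p ^ Suc n) (B ** mat_S ** mat_S) = coset (p ^ Suc n) B"
    by (subst coset_eq_iff)
      (simp_all add: B SL2Z_mult mat_S_SL2Z, simp add: matrix_mult_entry mat_S_def)
  then show "(right_translate mat_S ^^ 2) X = X"
    by (simp add: X right_translate_coset numeral_2_eq_2)
  show "right_translate mat_S X \<noteq> X"
  proof
    assume "right_translate mat_S X = X"
    then have "int (p ^ Suc n) dvd (B ** mat_S)$2$1 * B$2$2 - (B ** mat_S)$2$2 * B$2$1"
      by (simp add: X right_translate_coset coset_eq_iff B SL2Z_mult mat_S_SL2Z del: power_Suc)
    then have "int p dvd (B ** mat_S)$2$1 * B$2$2 - (B ** mat_S)$2$2 * B$2$1"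
      by (metis dvd_mult_left of_nat_mult power_Suc)
    then have "int p dvd (B$2$1)\<^sup>2 + (B$2$2)\<^sup>2"
      by (simp add: matrix_mult_entry mat_S_def power2_eq_square algebra_simps)
    then show False
      using prime_dvd_sum_two_squares[OF p mod4] SL2Z_bottom_row_not_both_dvd[OF B p] by blast
  qed
qed (use p in \<open>simp_all add: finite_Gamma0_cosets_prime_power right_translate_Gamma0_cosets
        mat_S_SL2Z two_is_prime_nat del: power_Suc\<close>)

text \<open>
  The coset of \<open>(c : d)\<close> goes to that of \<open>(d : d - c)\<close>. It is fixed if and only if \<open>p\<^bsup>n + 1\<^esup>\<close>
  divides \<open>c\<^sup>2 - c d + d\<^sup>2\<close>.
\<close>

lemma num_orbits_mat_ST:
  assumes p: "prime p" and mod3: "p mod 3 = 2"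
  shows "3 * num_orbits (p ^ Suc n) (mat_S ** mat_T) = card (Gamma0_cosets (p ^ Suc n))"
  unfolding num_orbits_def
proof (rule card_orbits_of_prime_order)
  let ?M = "mat_S ** mat_T"
  have M: "?M \<in> SL2Z" by (intro SL2Z_mult mat_S_SL2Z mat_T_SL2Z)
  fix X assume "X \<in> Gamma0_cosets (p ^ Suc n)"
  then obtain B where B: "B \<in> SL2Z" and X: "X = coset (p ^ Suc n) B"
    by (auto simp: Gamma0_cosets_def)
  \<comment> \<open>Here \<open>(S T)\<^sup>3 = - 1\<close>.\<close>
  have "coset (p ^ Suc n) (B ** ?M ** ?M ** ?M) = coset (p ^ Suc n) B"
    by (subst coset_eq_iff)
      (simp_all add: B SL2Z_mult M, simp add: matrix_mult_entry mat_S_def mat_T_def algebra_simps)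
  then show "(right_translate ?M ^^ 3) X = X"
    by (simp add: X right_translate_coset numeral_3_eq_3)
  show "right_translate ?M X \<noteq> X"
  proof
    assume "right_translate ?M X = X"
    then have "int (p ^ Suc n) dvd (B ** ?M)$2$1 * B$2$2 - (B ** ?M)$2$2 * B$2$1"
      by (simp add: X right_translate_coset coset_eq_iff B SL2Z_mult M del: power_Suc)
    then have "int p dvd (B ** ?M)$2$1 * B$2$2 - (B ** ?M)$2$2 * B$2$1"
      by (metis dvd_mult_left of_nat_mult power_Suc)
    then have "int p dvd (B$2$1)\<^sup>2 - B$2$1 * B$2$2 + (B$2$2)\<^sup>2"
      by (simp add: matrix_mult_entry mat_S_def mat_T_def power2_eq_square algebra_simps)
    then show False
      using prime_dvd_eisenstein_norm[OF p mod3] SL2Z_bottom_row_not_both_dvd[OF B p] by blast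
  qed
qed (use p in \<open>simp_all add: finite_Gamma0_cosets_prime_power right_translate_Gamma0_cosets
        mat_S_SL2Z mat_T_SL2Z SL2Z_mult del: power_Suc\<close>)

section \<open>The growth of the genus\<close>

text \<open>
  As \<open>T\<close> sends \<open>(1 : j)\<close> to \<open>(1 : j + 1)\<close>, the first family of cosets is a single orbit. Counting
  one orbit for each of the \<open>p\<^sup>n\<close> other cosets is generous, but it is of smaller order than the number
  of all cosets.
\<close>

lemma num_orbits_mat_T_le:
  assumes p: "prime p"
  shows "num_orbits (p ^ Suc n) mat_T \<le> p ^ n + 1"
proof -
  let ?N = "p ^ Suc n" and ?f = "right_translate mat_T"
  let ?B = "(\<lambda>k. coset (p ^ Suc n) (unit_second (p * k))) ` {..<p ^ n}"
  have N0: "?N > 0" using p prime_gt_0_nat by simp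
  have mult: "unit_first i ** mat_T = unit_first (Suc i)" for i
    by (simp add: matrix2_eq_iff matrix_mult_entry unit_first_def mat_T_def)
  have "((\<lambda>A. A ** mat_T) ^^ i) (unit_first 0) = unit_first i" for i
    by (induction i) (simp_all add: mult)
  then have pow: "(?f ^^ i) (coset ?N (unit_first 0)) = coset ?N (unit_first i)" for i
    by (simp add: funpow_right_translate del: power_Suc)
  have "coset ?N (unit_first ?N) = coset ?N (unit_first 0)"
    by (simp add: coset_unit_first_eq_iff)
  then have per: "(?f ^^ ?N) (coset ?N (unit_first 0)) = coset ?N (unit_first 0)"
    using pow[of ?N] by simp
  have cyc: "cyclic_on ?f (orbit ?f (coset ?N (unit_first 0)))"
    by (rule cyclic_on_orbit_of_finite_order[OF per N0])
  have "coset ?N (unit_first i) \<in> orbit ?f (coset ?N (unit_first 0))" if "i < ?N" for i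
    unfolding orbit_altdef_bounded[OF per N0] using pow[of i] that by force
  then have "orbit ?f (coset ?N (unit_first i)) = orbit ?f (coset ?N (unit_first 0))" if "i < ?N" for i
    using orbit_cyclic_eq3[OF cyc] that by blast
  then have "orbit ?f ` Gamma0_cosets ?N \<subseteq>
      insert (orbit ?f (coset ?N (unit_first 0))) (orbit ?f ` ?B)"
    unfolding Gamma0_cosets_prime_power[OF p] by blast
  then have "num_orbits ?N mat_T \<le> card (insert (orbit ?f (coset ?N (unit_first 0))) (orbit ?f ` ?B))"
    unfolding num_orbits_def by (rule card_mono[rotated]) simp
  also have "\<dots> \<le> Suc (card (orbit ?f ` ?B))"
    by (rule card_insert_le_m1) auto
  also have "card (orbit ?f ` ?B) \<le> card {..<p ^ n}"
    by (meson card_image_le finite_imageI finite_lessThan le_trans)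
  finally show ?thesis by simp
qed

lemma tendsto_primes_11_mod_12:
  "(f \<longlongrightarrow> l) at_top \<Longrightarrow> (f \<longlongrightarrow> l) primes_11_mod_12"
  unfolding primes_11_mod_12_def by (rule tendsto_mono[OF inf_le1])

lemma eventually_primes_11_mod_12:
  "eventually (\<lambda>p. prime p \<and> p mod 12 = 11) primes_11_mod_12"
  unfolding primes_11_mod_12_def by (rule eventually_inf_principal[THEN iffD2]) simp

lemma genus_X0_bounds:
  assumes p: "prime p" and mod12: "p mod 12 = 11"
  shows "genus_X0 (p ^ Suc n) \<le> 1 + (real p ^ Suc n + real p ^ n) / 12"
    and "genus_X0 (p ^ Suc n) \<ge> 1 + (real p ^ Suc n + real p ^ n) / 12 - (real p ^ n + 1) / 2"
proof -
  have mods: "p mod 4 = 3" "p mod 3 = 2" using mod12 by presburger+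
  let ?N = "p ^ Suc n"
  have S: "2 * real (num_orbits ?N mat_S) = real p ^ Suc n + real p ^ n"
    using arg_cong[OF num_orbits_mat_S[OF p mods(1), of n], of real]
    by (simp add: card_Gamma0_cosets_prime_power[OF p] del: power_Suc)
  have ST: "3 * real (num_orbits ?N (mat_S ** mat_T)) = real p ^ Suc n + real p ^ n"
    using arg_cong[OF num_orbits_mat_ST[OF p mods(2), of n], of real]
    by (simp add: card_Gamma0_cosets_prime_power[OF p] del: power_Suc)
  have T: "real (num_orbits ?N mat_T) \<le> real p ^ n + 1"
    using num_orbits_mat_T_le[OF p, of n] by (metis of_nat_1 of_nat_add of_nat_le_iff of_nat_power)
  have genus: "genus_X0 ?N = 1 + (real p ^ Suc n + real p ^ n) / 12 - real (num_orbits ?N mat_T) / 2"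
    using S ST by (simp add: genus_X0_def euler_char_X0_def card_Gamma0_cosets_prime_power[OF p]
        field_simps del: power_Suc)
  show "genus_X0 ?N \<le> 1 + (real p ^ Suc n + real p ^ n) / 12"
    unfolding genus by linarith
  show "genus_X0 ?N \<ge> 1 + (real p ^ Suc n + real p ^ n) / 12 - (real p ^ n + 1) / 2"
    unfolding genus using T by (intro diff_left_mono divide_right_mono) simp_all
qed

lemma genus_X0_cube_asymp:
  "((\<lambda>p. genus_X0 (p ^ 3) / real p ^ 3) \<longlongrightarrow> 1 / 12) primes_11_mod_12"
proof (rule tendsto_sandwich)
  have ev: "\<forall>\<^sub>F p in primes_11_mod_12. prime p \<and> p mod 12 = 11"
    by (rule eventually_primes_11_mod_12)
  show "\<forall>\<^sub>F p in primes_11_mod_12.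
      (1 + (real p ^ 3 + real p ^ 2) / 12 - (real p ^ 2 + 1) / 2) / real p ^ 3
      \<le> genus_X0 (p ^ 3) / real p ^ 3"
    using ev by eventually_elim
      (use genus_X0_bounds(2)[of _ 2] in \<open>auto simp: numeral_3_eq_3 numeral_2_eq_2 intro!: divide_right_mono\<close>)
  show "\<forall>\<^sub>F p in primes_11_mod_12.
      genus_X0 (p ^ 3) / real p ^ 3 \<le> (1 + (real p ^ 3 + real p ^ 2) / 12) / real p ^ 3"
    using ev by eventually_elim
      (use genus_X0_bounds(1)[of _ 2] in \<open>auto simp: numeral_3_eq_3 numeral_2_eq_2 intro!: divide_right_mono\<close>)
  show "((\<lambda>p. (1 + (real p ^ 3 + real p ^ 2) / 12 - (real p ^ 2 + 1) / 2) / real p ^ 3)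
      \<longlongrightarrow> 1 / 12) primes_11_mod_12"
    by (rule tendsto_primes_11_mod_12) real_asymp
  show "((\<lambda>p. (1 + (real p ^ 3 + real p ^ 2) / 12) / real p ^ 3) \<longlongrightarrow> 1 / 12) primes_11_mod_12"
    by (rule tendsto_primes_11_mod_12) real_asymp
qed

section \<open>Leading terms of the intersection numbers\<close>

text \<open>
  This grading is chosen so that every term of an intersection number of \<open>V_zero\<close> and
  \<open>V_infinity\<close> has order at most \<open>p\<^sup>3\<close>: the largest entries of the matrix belong to the
  components along which the multiplicities stay bounded.
\<close>

definition weight :: "component \<Rightarrow> nat" where
  "weight = case_component 0 0 1 1 1 1 1"

text \<open>
  The coefficients of \<open>p\<close> to the power \<open>3 - weight C - weight D\<close>. All entries with an exceptional
  component are too small to contribute.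
\<close>

definition leading_intersection :: "component \<Rightarrow> component \<Rightarrow> real" where
  "leading_intersection C D = (case C of
       C30 \<Rightarrow> case_component (-1/12) 0 (1/12) 0 0 0 0 D
     | C03 \<Rightarrow> case_component 0 (-1/12) 0 (1/12) 0 0 0 D
     | C21 \<Rightarrow> case_component (1/12) 0 (-1/6) (1/12) 0 0 0 D
     | C12 \<Rightarrow> case_component 0 (1/12) (1/12) (-1/6) 0 0 0 D
     | _ \<Rightarrow> 0)"

definition leading_multiplicity :: "component \<Rightarrow> real" where
  "leading_multiplicity = case_component (5/3) (-4/3) (2/3) (-1/3) (1/6) (1/3) 0"

lemmas of_rat_hom = of_rat_add of_rat_diff of_rat_mult of_rat_divide of_rat_power of_rat_minus

lemma component_intersection_asymp:
  "((\<lambda>p. real_of_rat (component_intersection p C D) * real p ^ (weight C + weight D) / real p ^ 3)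
     \<longlongrightarrow> leading_intersection C D) at_top"
  by (cases C; cases D;
      simp add: component_intersection_def Let_def weight_def leading_intersection_def of_rat_hom;
      real_asymp)

lemma V_zero_asymp:
  "((\<lambda>p. real_of_rat (V_zero p C) / real p ^ weight C) \<longlongrightarrow> leading_multiplicity C) at_top"
  by (cases C;
      simp add: V_zero_def Let_def weight_def leading_multiplicity_def of_rat_hom; real_asymp)

lemma V_infinity_asymp:
  "((\<lambda>p. real_of_rat (V_infinity p C) / real p ^ weight C) \<longlongrightarrow> - leading_multiplicity C) at_top"
  by (cases C;
      simp add: V_infinity_def Let_def weight_def leading_multiplicity_def of_rat_hom; real_asymp)

lemma intersection_number_asymp:
  assumes V: "\<And>C. ((\<lambda>p. real_of_rat (V p C) / real p ^ weight C) \<longlongrightarrow> v C) at_top"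
    and W: "\<And>C. ((\<lambda>p. real_of_rat (W p C) / real p ^ weight C) \<longlongrightarrow> w C) at_top"
  shows "((\<lambda>p. real_of_rat (intersection_number p (V p) (W p)) / real p ^ 3) \<longlongrightarrow>
      (\<Sum>C\<in>UNIV. \<Sum>D\<in>UNIV. v C * w D * leading_intersection C D)) at_top"
proof (rule Lim_transform_eventually)
  show "((\<lambda>p. \<Sum>C\<in>UNIV. \<Sum>D\<in>UNIV.
      (real_of_rat (V p C) / real p ^ weight C) * (real_of_rat (W p D) / real p ^ weight D) *
      (real_of_rat (component_intersection p C D) * real p ^ (weight C + weight D) / real p ^ 3))
      \<longlongrightarrow> (\<Sum>C\<in>UNIV. \<Sum>D\<in>UNIV. v C * w D * leading_intersection C D)) at_top"
    by (intro tendsto_sum tendsto_mult V W component_intersection_asymp)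
  show "\<forall>\<^sub>F p in at_top. (\<Sum>C\<in>UNIV. \<Sum>D\<in>UNIV.
      (real_of_rat (V p C) / real p ^ weight C) * (real_of_rat (W p D) / real p ^ weight D) *
      (real_of_rat (component_intersection p C D) * real p ^ (weight C + weight D) / real p ^ 3))
      = real_of_rat (intersection_number p (V p) (W p)) / real p ^ 3"
    using eventually_gt_at_top[of 0]
  proof eventually_elim
    case (elim p)
    then show ?case
      unfolding intersection_number_def of_rat_sum sum_divide_distrib
      by (intro sum.cong refl) (simp add: of_rat_mult power_add)
  qed
qed

text \<open>
  Over the common denominator, the nonzero products are
  \<open>(- 25 - 16 + 2 \<cdot> 10 + 2 \<cdot> 4 - 8 - 2 - 4) / (9 \<cdot> 12) = - 27 / 108\<close>.
\<close>

lemma leading_self_intersection: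
  "(\<Sum>C\<in>UNIV. \<Sum>D\<in>UNIV.
      leading_multiplicity C * leading_multiplicity D * leading_intersection C D) = - 1 / 4"
  by (simp add: UNIV_component leading_multiplicity_def leading_intersection_def)

lemma intersection_numbers_V_asymp:
  "((\<lambda>p. real_of_rat (intersection_number p (V_zero p) (V_infinity p)) / real p ^ 3)
      \<longlongrightarrow> 1 / 4) at_top"
  "((\<lambda>p. real_of_rat (intersection_number p (V_zero p) (V_zero p)) / real p ^ 3)
      \<longlongrightarrow> - 1 / 4) at_top"
  "((\<lambda>p. real_of_rat (intersection_number p (V_infinity p) (V_infinity p)) / real p ^ 3)
      \<longlongrightarrow> - 1 / 4) at_top"
  using intersection_number_asymp[OF V_zero_asymp V_infinity_asymp]
    intersection_number_asymp[OF V_zero_asymp V_zero_asymp]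
    intersection_number_asymp[OF V_infinity_asymp V_infinity_asymp]
  by (simp_all add: sum_negf leading_self_intersection)

section \<open>The limit\<close>

theorem proposition4p8:
  shows "(\<lambda>p. 1 / (genus_X0 (p^3) - 1) *
              (genus_X0 (p^3) * arakelov_pairing p (V_zero p) (V_infinity p)
               - (arakelov_pairing p (V_zero p) (V_zero p)
                  + arakelov_pairing p (V_infinity p) (V_infinity p)) / 2)
            - 3 * genus_X0 (p^3) * ln (real p))
         \<in> o[primes_11_mod_12](\<lambda>p. genus_X0 (p^3) * ln (real p))"
proof -
  let ?F = primes_11_mod_12
  define g where "g p = genus_X0 (p ^ 3)" for p
  define q where "q p = real p ^ 3" for p
  define a where "a p = real_of_rat (intersection_number p (V_zero p) (V_infinity p))" for p
  define b where "b p = real_of_rat (intersection_number p (V_zero p) (V_zero p))" for p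
  define c where "c p = real_of_rat (intersection_number p (V_infinity p) (V_infinity p))" for p
  have limg: "((\<lambda>p. g p / q p) \<longlongrightarrow> 1 / 12) ?F"
    unfolding g_def q_def by (rule genus_X0_cube_asymp)
  have lima: "((\<lambda>p. a p / q p) \<longlongrightarrow> 1 / 4) ?F"
    and limb: "((\<lambda>p. b p / q p) \<longlongrightarrow> - 1 / 4) ?F"
    and limc: "((\<lambda>p. c p / q p) \<longlongrightarrow> - 1 / 4) ?F"
    unfolding a_def b_def c_def q_def
    by (intro tendsto_primes_11_mod_12 intersection_numbers_V_asymp)+
  have limq: "((\<lambda>p. 1 / q p) \<longlongrightarrow> 0) ?F"
    unfolding q_def by (rule tendsto_primes_11_mod_12) real_asymp
  \<comment> \<open>This is the quotient by \<open>g log p\<close>, rewritten in terms of quantities that converge.\<close>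
  have "((\<lambda>p. 1 / (g p / q p - 1 / q p) *
           (a p / q p - (1 / q p) * (b p / q p + c p / q p) / (2 * (g p / q p))) - 3)
      \<longlongrightarrow> 1 / (1 / 12 - 0) * (1 / 4 - 0 * (- 1 / 4 + - 1 / 4) / (2 * (1 / 12))) - 3) ?F"
    by (intro tendsto_intros limg lima limb limc limq) auto
  then have lim: "((\<lambda>p. 1 / (g p / q p - 1 / q p) *
           (a p / q p - (1 / q p) * (b p / q p + c p / q p) / (2 * (g p / q p))) - 3)
      \<longlongrightarrow> 0) ?F"
    by simp
  have g_pos: "\<forall>\<^sub>F p in ?F. g p / q p > 0"
    using order_tendstoD(1)[OF limg, of 0] by simp
  have g_gt_1: "\<forall>\<^sub>F p in ?F. g p / q p - 1 / q p > 0"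
    using order_tendstoD(1)[OF tendsto_diff[OF limg limq], of 0] by simp
  have p_ge: "\<forall>\<^sub>F p in ?F. p > 1"
    using eventually_primes_11_mod_12 by eventually_elim (auto dest: prime_gt_1_nat)
  show ?thesis
  proof (rule smalloI_tendsto)
    show "\<forall>\<^sub>F p in ?F. genus_X0 (p ^ 3) * ln (real p) \<noteq> 0"
      using g_pos p_ge by eventually_elim (auto simp: g_def)
    show "((\<lambda>p. (1 / (genus_X0 (p^3) - 1) *
              (genus_X0 (p^3) * arakelov_pairing p (V_zero p) (V_infinity p)
               - (arakelov_pairing p (V_zero p) (V_zero p)
                  + arakelov_pairing p (V_infinity p) (V_infinity p)) / 2)
            - 3 * genus_X0 (p^3) * ln (real p)) / (genus_X0 (p^3) * ln (real p))) \<longlongrightarrow> 0) ?F"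
    proof (rule Lim_transform_eventually[OF lim])
      show "\<forall>\<^sub>F p in ?F. 1 / (g p / q p - 1 / q p) *
           (a p / q p - (1 / q p) * (b p / q p + c p / q p) / (2 * (g p / q p))) - 3 =
          (1 / (genus_X0 (p^3) - 1) *
              (genus_X0 (p^3) * arakelov_pairing p (V_zero p) (V_infinity p)
               - (arakelov_pairing p (V_zero p) (V_zero p)
                  + arakelov_pairing p (V_infinity p) (V_infinity p)) / 2)
            - 3 * genus_X0 (p^3) * ln (real p)) / (genus_X0 (p^3) * ln (real p))"
        using g_pos g_gt_1 p_ge
      proof eventually_elim
        case (elim p)
        have q: "q p > 0" and L: "ln (real p) > 0" using elim(3) by (auto simp: q_def)
        have g: "g p > 0" "g p - 1 > 0"
          using elim(1,2) q by (auto simp: zero_less_divide_iff simp flip: diff_divide_distrib)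
        have "1 / (g p / q p - 1 / q p) *
           (a p / q p - (1 / q p) * (b p / q p + c p / q p) / (2 * (g p / q p))) - 3
          = 1 / (g p - 1) * (a p - (b p + c p) / (2 * g p)) - 3"
          using q g by (simp add: divide_simps)
        also have "\<dots> = (1 / (g p - 1) * (g p * (a p * ln (real p)) -
            (b p * ln (real p) + c p * ln (real p)) / 2) - 3 * g p * ln (real p)) / (g p * ln (real p))"
          using L g by (simp add: divide_simps) (simp add: algebra_simps)
        finally show ?case
          by (simp add: arakelov_pairing_def g_def a_def b_def c_def)
      qed
    qed
  qed
qed

end
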